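(* Let $F(t)=-t^2+t-1$ and $G(t)=t(t^4-2t^3+4t^2-3t+3)$. Let $f,g\in\mathbb{Q}[t]$ with $\deg f=2$, $\deg g=5$. Then $g$ divides $f^3+1$ and $f$ divides $g^3+1$ in $\mathbb{Q}[t]$ if and only if there exist $\alpha\in\mathbb{Q}\setminus\{0\}$ and $\beta\in\mathbb{Q}$ such that $f(t)=F(\alpha t+\beta)$ and $g(t)=G(\alpha t+\beta)$.
   Context: Solutions are considered up to affine reparametrization $t\mapsto\alpha t+\beta$ ($\alpha\in\mathbb{Q}\setminus\{0\}$, $\beta\in\mathbb{Q}$). (Since $\gcd(2,5)=1$, no such pair is a composition with a polynomial of degree at least $2$.) *)

theory Defs
  imports "HOL-Computational_Algebra.Polynomial"
begin

definition F :: "rat poly" where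
  "F = [:-1, 1, -1:]"

definition G :: "rat poly" where
  "G = [:0, 1:] * [:3, -3, 4, -2, 1:]"

end

theory Submission
  imports Defs
begin

text \<open>
  Comparing degrees, \<open>f\<^sup>3 + 1 = g * l\<close> with \<open>l\<close> linear. At the root of \<open>l\<close> the value
  of \<open>f\<close> is a rational cube root of \<open>-1\<close>, hence \<open>-1\<close>; so \<open>f + 1 = l * m\<close> with \<open>m\<close> linear, and
  \<open>g = m * (f\<^sup>2 - f + 1)\<close>. Modulo \<open>f\<close> this gives \<open>g \<equiv> m\<close>, so \<open>f\<close> divides \<open>m\<^sup>3 + 1\<close>.
  The linear cofactor divides \<open>m + 1\<close> for the same reason as before, whence
  \<open>f = c * (m\<^sup>2 - m + 1)\<close>, and evaluation at the root of \<open>m\<close> gives \<open>c = -1\<close>. Thus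
  \<open>f = F \<circ> m\<close> and \<open>g = G \<circ> m\<close>.
\<close>

lemma linear_poly_has_root:
  fixes q :: "'a::field poly"
  assumes "degree q = 1"
  obtains s where "poly q s = 0"
proof -
  obtain a b where q: "q = [:b, a:]" "a \<noteq> 0"
    using assms by (metis degree1_coeffs)
  show thesis
    by (rule that[of "- b / a"]) (simp add: q)
qed

lemma linear_poly_dvd_iff:
  fixes q p :: "'a::field poly"
  assumes "degree q = 1" and "poly q s = 0"
  shows "q dvd p \<longleftrightarrow> poly p s = 0"
proof -
  obtain a b where q: "q = [:b, a:]" "a \<noteq> 0"
    using assms(1) by (metis degree1_coeffs)
  then have "q = smult a [:- s, 1:]"
    using assms(2) by (simp add: add_eq_0_iff2 mult.commute)
  then show ?thesis
    using q(2) by (simp only: smult_dvd_iff poly_eq_0_iff_dvd) simp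
qed

text \<open>In an ordered field x^2 - x + 1 is always positive, so -1 has no cube root but itself;
  \<open>p\<close> therefore takes the value -1 at the root of \<open>q\<close>. Applied once to the
  cofactor of \<open>g\<close> and once to that of \<open>f\<close>.\<close>

lemma linear_dvd_cube_plus_1:
  fixes p q :: "'a::linordered_field poly"
  assumes "degree q = 1" and "q dvd p ^ 3 + 1"
  shows "q dvd p + 1"
proof -
  obtain s where s: "poly q s = 0"
    using linear_poly_has_root[OF assms(1)] .
  have "poly p s ^ 3 + 1 = 0"
    using assms(2) linear_poly_dvd_iff[OF assms(1) s, of "p ^ 3 + 1"] by simp
  then have "(poly p s + 1) * ((poly p s)\<^sup>2 - poly p s + 1) = 0"
    by (simp add: algebra_simps power2_eq_square power3_eq_cube)
  moreover have "(poly p s)\<^sup>2 - poly p s + 1 > 0"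
  proof -
    \<comment> \<open>Completing the square; the factor 4 avoids fractions.\<close>
    have "4 * ((poly p s)\<^sup>2 - poly p s + 1) = (2 * poly p s - 1)\<^sup>2 + 3"
      by (simp add: algebra_simps power2_eq_square)
    also have "\<dots> > 0"
      by (simp add: add_nonneg_pos)
    finally show ?thesis
      by (simp add: zero_less_mult_iff)
  qed
  ultimately have "poly (p + 1) s = 0"
    by simp
  then show ?thesis
    using linear_poly_dvd_iff[OF assms(1) s] by simp
qed

lemma cube_plus_1_factor:
  fixes x :: "'a::comm_ring_1"
  shows "x ^ 3 + 1 = (x + 1) * (x\<^sup>2 - x + 1)"
  by (simp add: algebra_simps power2_eq_square power3_eq_cube)

text \<open>The factor \<open>f\<^sup>2 - f + 1\<close> is congruent to 1 modulo \<open>f\<close>,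
  so it drops out of the cube. Both directions of the theorem rely on this.\<close>

lemma dvd_cube_plus_1_iff:
  fixes f m :: "'a::comm_ring_1"
  shows "f dvd (m * (f\<^sup>2 - f + 1)) ^ 3 + 1 \<longleftrightarrow> f dvd m ^ 3 + 1"
proof -
  define h where "h = f\<^sup>2 - f + 1"
  have "h - 1 = f * (f - 1)"
    by (simp add: h_def algebra_simps power2_eq_square)
  \<comment> \<open>Difference of cubes h^3 - 1, multiplied by m^3.\<close>
  moreover have "(m * h) ^ 3 + 1 = (h - 1) * (m ^ 3 * (h\<^sup>2 + h + 1)) + (m ^ 3 + 1)"
    by (simp add: algebra_simps power2_eq_square power3_eq_cube)
  ultimately have "(m * h) ^ 3 + 1 = f * ((f - 1) * (m ^ 3 * (h\<^sup>2 + h + 1))) + (m ^ 3 + 1)"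
    by (simp add: mult.assoc)
  then show ?thesis
    unfolding h_def by (metis dvd_triv_left dvd_add_right_iff)
qed

lemma pcompose_F: "pcompose F u = - (u\<^sup>2 - u + 1)"
  by (simp add: F_def pcompose_pCons algebra_simps power2_eq_square one_pCons)

text \<open>The quintic \<open>G\<close> is t * (F^2 - F + 1), and composition with \<open>u\<close>
  preserves this identity.\<close>

lemma pcompose_G: "pcompose G u = u * ((pcompose F u)\<^sup>2 - pcompose F u + 1)"
proof -
  have "G = [:0, 1:] * (F\<^sup>2 - F + 1)"
    by (simp add: F_def G_def power2_eq_square one_pCons)
  then have "pcompose G u = pcompose [:0, 1:] u * pcompose (F\<^sup>2 - F + 1) u"
    by (metis pcompose_mult)
  then show ?thesis
    by (simp add: pcompose_mult pcompose_add pcompose_diff pcompose_pCons pcompose_1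
        power2_eq_square)
qed

theorem theorem2p5:
  fixes f g :: "rat poly"
  assumes "degree f = 2" and "degree g = 5"
  shows "(g dvd f ^ 3 + 1 \<and> f dvd g ^ 3 + 1) \<longleftrightarrow>
    (\<exists>\<alpha> \<beta> :: rat. \<alpha> \<noteq> 0 \<and> f = pcompose F [:\<beta>, \<alpha>:] \<and> g = pcompose G [:\<beta>, \<alpha>:])"
proof
  assume dvd: "g dvd f ^ 3 + 1 \<and> f dvd g ^ 3 + 1"
  have "f \<noteq> 0" "g \<noteq> 0"
    using assms by auto
  have deg_f1: "degree (f + 1) = 2"
    using assms(1) by (simp add: degree_add_eq_left)
  then have "f + 1 \<noteq> 0"
    by auto
  obtain l where l: "f ^ 3 + 1 = g * l"
    using dvd by auto
  have "degree (f ^ 3 + 1) = 6"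
    using assms(1) \<open>f \<noteq> 0\<close> by (simp add: degree_add_eq_left degree_power_eq)
  with l have deg_gl: "degree (g * l) = 6"
    by simp
  then have "l \<noteq> 0"
    by auto
  with deg_gl assms(2) have "degree l = 1"
    using \<open>g \<noteq> 0\<close> by (simp add: degree_mult_eq)
  have "l dvd f + 1"
    by (rule linear_dvd_cube_plus_1) (simp_all add: l \<open>degree l = 1\<close>)
  then obtain m where m: "f + 1 = l * m" ..
  with \<open>f + 1 \<noteq> 0\<close> have "m \<noteq> 0"
    by auto
  with m deg_f1 have "degree m = 1"
    using \<open>l \<noteq> 0\<close> \<open>degree l = 1\<close> by (simp add: degree_mult_eq)
  \<comment> \<open>Both sides equal f^3 + 1, the right one through (f + 1) * (f^2 - f + 1) with f +
    1 = l * m.\<close>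
  have "l * g = l * (m * (f\<^sup>2 - f + 1))"
    using l unfolding cube_plus_1_factor m by (simp only: mult_ac)
  then have g: "g = m * (f\<^sup>2 - f + 1)"
    using \<open>l \<noteq> 0\<close> by (metis mult_left_cancel)
  then have "f dvd m ^ 3 + 1"
    using dvd dvd_cube_plus_1_iff by metis
  then obtain q where q: "m ^ 3 + 1 = f * q" ..
  have "degree (m ^ 3 + 1) = 3"
    using \<open>m \<noteq> 0\<close> \<open>degree m = 1\<close> by (simp add: degree_add_eq_left degree_power_eq)
  with q have deg_fq: "degree (f * q) = 3"
    by simp
  then have "q \<noteq> 0"
    by auto
  with deg_fq assms(1) have "degree q = 1"
    using \<open>f \<noteq> 0\<close> by (simp add: degree_mult_eq)
  have "q dvd m + 1"
    by (rule linear_dvd_cube_plus_1) (simp_all add: q \<open>degree q = 1\<close>)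
  then obtain c where c: "m + 1 = q * c" ..
  have deg_m1: "degree (m + 1) = 1"
    using \<open>degree m = 1\<close> by (simp add: degree_add_eq_left)
  \<comment> \<open>Comparing degrees in m + 1 = q * c settles nonzero \<open>c\<close>; the zero
    polynomial has degree 0 by convention.\<close>
  have "degree c = 0"
  proof (cases "c = 0")
    case False
    with c deg_m1 show ?thesis
      using \<open>q \<noteq> 0\<close> \<open>degree q = 1\<close> by (simp add: degree_mult_eq)
  qed simp
  then obtain d where d: "c = [:d:]"
    by (metis degree_eq_zeroE)
  have "q * f = q * (c * (m\<^sup>2 - m + 1))"
    using q unfolding cube_plus_1_factor c by (simp only: mult_ac)
  then have f: "f = c * (m\<^sup>2 - m + 1)"
    using \<open>q \<noteq> 0\<close> by (metis mult_left_cancel)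
  obtain s where s: "poly m s = 0"
    using linear_poly_has_root[OF \<open>degree m = 1\<close>] .
  \<comment> \<open>At the root \<open>s\<close> of \<open>m\<close>, \<open>f\<close> takes the
    value -1 because \<open>m\<close> divides f + 1, and the value \<open>d\<close> by the formula
    for \<open>f\<close>.\<close>
  have "poly (f + 1) s = 0"
    by (simp only: m poly_mult s mult_zero_right)
  then have "d = -1"
    by (simp add: f d s add_eq_0_iff2)
  then have F: "f = pcompose F m"
    using f d by (simp add: pcompose_F)
  with g have G: "g = pcompose G m"
    by (simp add: pcompose_G)
  obtain \<alpha> \<beta> where "m = [:\<beta>, \<alpha>:]" "\<alpha> \<noteq> 0"
    using \<open>degree m = 1\<close> by (metis degree1_coeffs)
  with F G show "\<exists>\<alpha> \<beta>. \<alpha> \<noteq> 0 \<and> f = pcompose F [:\<beta>, \<alpha>:] \<and> g = pcompose G [:\<beta>, \<alpha>:]"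
    by blast
next
  assume "\<exists>\<alpha> \<beta>. \<alpha> \<noteq> 0 \<and> f = pcompose F [:\<beta>, \<alpha>:] \<and> g = pcompose G [:\<beta>, \<alpha>:]"
  then obtain u where u: "f = pcompose F u" "g = pcompose G u"
    by blast
  then have f: "f = - (u\<^sup>2 - u + 1)" and g: "g = u * (f\<^sup>2 - f + 1)"
    by (simp_all only: pcompose_F pcompose_G)
  \<comment> \<open>Conversely the linear cofactors are explicit: 1 - u for \<open>g\<close>, and
    -(u + 1) for \<open>f\<close> after reducing g^3 + 1 to u^3 + 1.\<close>
  have "f + 1 = u * (1 - u)"
    by (simp add: f algebra_simps power2_eq_square)
  then have "f ^ 3 + 1 = g * (1 - u)"
    by (simp add: cube_plus_1_factor g mult_ac)
  moreover have "u ^ 3 + 1 = f * (- (u + 1))"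
    unfolding cube_plus_1_factor f by (simp only: minus_mult_minus mult.commute)
  then have "f dvd g ^ 3 + 1"
    unfolding g dvd_cube_plus_1_iff by (rule dvdI)
  ultimately show "g dvd f ^ 3 + 1 \<and> f dvd g ^ 3 + 1"
    by simp
qed

end
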